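(* For all $L\in\mathbf N$, $$G\left(L,L+1,\tfrac{13}{4},2,4,q\right)\geq0.$$
   Context: $\mathbf N$ denotes the set of nonnegative integers. For $m\in\mathbf N$, $(q)_m=\prod_{j=1}^m(1-q^j)$, with $(q)_0=1$. The $q$-binomial coefficient is $\begin{bmatrix} m+n\\ m\end{bmatrix}_q=\frac{(q)_{m+n}}{(q)_m(q)_n}$ if $m,n\in\mathbf N$, and it is $0$ otherwise (so $\begin{bmatrix} A\\ B\end{bmatrix}_q=0$ unless $0\le B\le A$). Define $$G(N,M,\alpha,\beta,K,q)=\sum_{j=-\infty}^\infty(-1)^j q^{Kj\frac{(\alpha+\beta)j+(\alpha-\beta)}{2}}\begin{bmatrix} N+M\\ N-Kj\end{bmatrix}_q .$$ The notation $P(q)\ge 0$ means that $P(q)$ is a polynomial in $q$ with nonnegative coefficients. *)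

theory Defs
  imports Complex_Main "HOL-Library.Groups_Big_Fun" "HOL-Computational_Algebra.Polynomial"
begin

definition qpoch :: "nat \<Rightarrow> real \<Rightarrow> real" where
  "qpoch m q = (\<Prod>j=1..m. 1 - q ^ j)"

definition qbinom :: "int \<Rightarrow> int \<Rightarrow> real \<Rightarrow> real" where
  "qbinom A B q =
     (if 0 \<le> B \<and> B \<le> A
      then qpoch (nat A) q / (qpoch (nat B) q * qpoch (nat (A - B)) q)
      else 0)"

definition G_term :: "nat \<Rightarrow> nat \<Rightarrow> real \<Rightarrow> real \<Rightarrow> nat \<Rightarrow> real \<Rightarrow> int \<Rightarrow> real" where
  "G_term N M \<alpha> \<beta> K q j =
     (-1) powi j
     * q powr (real K * of_int j * (((\<alpha> + \<beta>) * of_int j + (\<alpha> - \<beta>)) / 2))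
     * qbinom (int N + int M) (int N - int K * j) q"

(* The variable q is read as a real number in (0,1), so that the quotients above are genuine
   and rational exponents make sense. Sum_any is the sum over all of its index type of a
   finitely supported function (and 0 otherwise); see finite_support_G_term. *)
definition G :: "nat \<Rightarrow> nat \<Rightarrow> real \<Rightarrow> real \<Rightarrow> nat \<Rightarrow> real \<Rightarrow> real" where
  "G N M \<alpha> \<beta> K q = Sum_any (\<lambda>j::int. G_term N M \<alpha> \<beta> K q j)"

lemma finite_support_G_term:
  assumes "K > 0"
  shows "finite {j. G_term N M \<alpha> \<beta> K q j \<noteq> 0}"
proof (rule finite_subset)
  show "{j. G_term N M \<alpha> \<beta> K q j \<noteq> 0} \<subseteq> {- int M..int N}"
  proof
    fix j assume "j \<in> {j. G_term N M \<alpha> \<beta> K q j \<noteq> 0}"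
    hence *: "int K * j \<le> int N" "- int M \<le> int K * j"
      by (auto simp: G_term_def qbinom_def split: if_splits)
    have "\<bar>j\<bar> \<le> \<bar>int K * j\<bar>"
      using assms mult_right_mono[of 1 "int K" "\<bar>j\<bar>"] by (simp add: abs_mult)
    moreover have "j \<ge> 0 \<longleftrightarrow> int K * j \<ge> 0"
      using assms by (simp add: zero_le_mult_iff)
    ultimately show "j \<in> {- int M..int N}" using * unfolding atLeastAtMost_iff by linarith
  qed
qed simp

(* P(q) >= 0: the expression P(q) is a polynomial in q with nonnegative coefficients.
   Agreement on (0,1) determines the polynomial; see poly_eq_on_unit_interval. *)
definition nonneg_poly :: "(real \<Rightarrow> real) \<Rightarrow> bool" where
  "nonneg_poly P \<longleftrightarrow>
     (\<exists>p :: real poly. (\<forall>i. coeff p i \<ge> 0) \<and> (\<forall>q. 0 < q \<and> q < 1 \<longrightarrow> P q = poly p q))"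

lemma poly_eq_on_unit_interval:
  fixes p r :: "real poly"
  assumes "\<And>q. 0 < q \<Longrightarrow> q < 1 \<Longrightarrow> poly p q = poly r q"
  shows "p = r"
proof (rule ccontr)
  assume "p \<noteq> r"
  hence "finite {x. poly (p - r) x = 0}" by (intro poly_roots_finite) simp
  moreover have "{0<..<1} \<subseteq> {x. poly (p - r) x = 0}" using assms by auto
  ultimately have "finite {0<..<1::real}" by (rule rev_finite_subset)
  thus False using infinite_Ioo[of 0 "1::real"] by simp
qed

end

theory Submission imports Defs begin

text \<open>
  Write \<open>T(a) = a(a+1)/2\<close>. The transformation (valid for every integer \<open>b\<close>)
  \<open>\<Sum>\<^sub>k\<^sub>,\<^sub>m q\<^bsup>T(m)+T(m+k)\<^esup> [L; k] [L-k; m] [k; \<lfloor>k/2\<rfloor> - b] = q\<^bsup>T(2b)\<^esup> [2L+1; L-2b]\<close>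
  has coefficients that are nonnegative polynomials. Split by the parity of \<open>k\<close>, its
  left-hand side collapses under two applications of the q-Vandermonde summation. Since
  \<open>j(21j+5)/2 = j(5j+1)/2 + T(4j)\<close>, taking \<open>b = 2j\<close> reduces the claim to the positivity of
  \<open>\<Sum>\<^sub>j (-1)\<^sup>j q\<^bsup>j(5j+1)/2\<^esup> [k; \<lfloor>k/2\<rfloor> - 2j]\<close>. For \<open>k = 2n\<close> and \<open>k = 2n+1\<close> this equals
  \<open>\<Sum>\<^sub>k q\<^bsup>k\<^sup>2\<^esup> [n; k]\<close>, Bressoud's finite form of the first Rogers--Ramanujan identity,
  which follows by comparing Pascal-type recurrences and reflecting the summation index.
\<close>

section \<open>Gaussian binomial coefficients\<close>

lemma qpoch_Suc: "qpoch (Suc n) q = qpoch n q * (1 - q ^ Suc n)"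
  by (simp add: qpoch_def)

lemma qpoch_0 [simp]: "qpoch 0 q = 1"
  by (simp add: qpoch_def)

lemma qbinom_eq_0: "B < 0 \<or> A < B \<Longrightarrow> qbinom A B q = 0"
  by (auto simp: qbinom_def)

lemma qbinom_symmetric: "qbinom A (A - B) q = qbinom A B q"
  by (auto simp: qbinom_def)

lemma qbinom_add: "qbinom (int a + int b) (int a) q = qpoch (a + b) q / (qpoch a q * qpoch b q)"
  by (simp add: qbinom_def nat_add_distrib)

text \<open>\<open>Sum_any\<close> defaults to 0 on infinite support, so every splitting or scaling
  of such a sum rests on this. For \<open>k\<close> nonzero the map j -> B - k*j is injective, hence
  hits the finite interval {0..A} only finitely often.\<close>

lemma finite_support_qbinom:
  assumes "k \<noteq> 0"
  shows "finite {j. c j * qbinom A (B - k * j) q \<noteq> 0}"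
proof (rule finite_subset)
  show "{j. c j * qbinom A (B - k * j) q \<noteq> 0} \<subseteq> {j. B - k * j \<in> {0..A}}"
    by (auto simp: qbinom_def split: if_splits)
  have "inj (\<lambda>j. B - k * j)"
    using assms by (auto simp: inj_def)
  thus "finite {j. B - k * j \<in> {0..A}}"
    using finite_vimageI[of "{0..A}" "\<lambda>j. B - k * j"] by (simp add: vimage_def)
qed

lemma finite_support_scaled_qbinom:
  "k \<noteq> 0 \<Longrightarrow> finite {j. a * (c j * qbinom A (B - k * j) q) \<noteq> 0}"
  using finite_support_qbinom[of k "\<lambda>j. a * c j" A B q] by (simp add: mult.assoc)

lemma finite_support_qbinom': "finite {j. c j * qbinom A j q \<noteq> 0}"
  using finite_support_qbinom[of "-1" c A 0 q] by simp

lemma finite_support_qbinom_diff: "finite {j. c j * qbinom A (j - i) q \<noteq> 0}"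
  using finite_support_qbinom[of "-1" c A "-i" q] by simp

text \<open>The Rogers-Ramanujan polynomial with a linear shift \<open>c\<close>. The recurrences
  move \<open>c\<close>, and the values 0, 1 and 2 all occur in the induction. Summing over all
  integers lets index shifts act without boundary terms.\<close>

definition RR_sum :: "real \<Rightarrow> int \<Rightarrow> nat \<Rightarrow> real" where
  "RR_sum q c n = Sum_any (\<lambda>k::int. q powr of_int (k\<^sup>2 + c * k) * qbinom (int n) k q)"

text \<open>The linear term \<open>d * j\<close> absorbs the factors q^(-2j) and q^(2j) that the two
  Pascal rules produce. Since j(5j+1) is even, the halved exponent is an integer.\<close>

definition alt_sum :: "real \<Rightarrow> int \<Rightarrow> int \<Rightarrow> int \<Rightarrow> real" where
  "alt_sum q d A B = Sum_any (\<lambda>j::int. (-1) powi j * q powr (of_int (j * (5 * j + 1)) / 2 + of_int (d * j))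
     * qbinom A (B - 2 * j) q)"

text \<open>The kernel of the transformation. It does not depend on \<open>b\<close>, so an
  alternating sum over \<open>b\<close> acts only on the remaining binomial.\<close>

definition trans_coeff :: "real \<Rightarrow> int \<Rightarrow> int \<Rightarrow> int \<Rightarrow> real" where
  "trans_coeff q L k m = q powr (of_int (m * (m + 1) + (m + k) * (m + k + 1)) / 2) *
     qbinom L k q * qbinom (L - k) m q"

context
  fixes q :: real
  assumes q: "0 < q" "q < 1"
begin

lemma qpoch_pos: "qpoch n q > 0"
  unfolding qpoch_def
  using q by (intro prod_pos) (simp add: power_less_one_iff)

lemma qpoch_nz [simp]: "qpoch n q \<noteq> 0"
  using qpoch_pos[of n] by simp

lemma qbinom_0 [simp]: "A \<ge> 0 \<Longrightarrow> qbinom A 0 q = 1"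
  by (simp add: qbinom_def)

lemma qbinom_self [simp]: "A \<ge> 0 \<Longrightarrow> qbinom A A q = 1"
  by (simp add: qbinom_def)

lemma qbinom_Pascal:
  assumes "A \<ge> 0"
  shows "qbinom (A + 1) B q = qbinom A (B - 1) q + q powr of_int B * qbinom A B q"
proof (cases "1 \<le> B \<and> B \<le> A")
  case True
  define b c where "b = nat (B - 1)" and "c = nat (A - B)"
  have B: "B = int (Suc b)" and A: "A = int (Suc b) + int c"
    using True by (auto simp: b_def c_def)
  have 1: "qbinom (A + 1) B q = qpoch (Suc (Suc (b + c))) q / (qpoch (Suc b) q * qpoch (Suc c) q)"
    using qbinom_add[of "Suc b" "Suc c" q] by (simp add: A B add_ac)
  have 2: "qbinom A (B - 1) q = qpoch (Suc (b + c)) q / (qpoch b q * qpoch (Suc c) q)"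
    using qbinom_add[of "b" "Suc c" q] by (simp add: A B add_ac)
  have 3: "qbinom A B q = qpoch (Suc (b + c)) q / (qpoch (Suc b) q * qpoch c q)"
    using qbinom_add[of "Suc b" "c" q] by (simp add: A B add_ac)
  have 4: "q powr of_int B = q ^ Suc b"
    using q powr_realpow[of q "Suc b"] by (simp add: B)
  have nz: "1 - q ^ Suc n \<noteq> 0" for n
    using q power_Suc_less_one[of q n] by auto
  \<comment> \<open>After cancelling common factors the rule becomes 1 - q^(b+c+2) = (1 - q^(b+1)) +
    q^(b+1) (1 - q^(c+1)).\<close>
  show ?thesis
    unfolding 1 2 3 4
    unfolding qpoch_Suc[of "Suc (b + c)"] qpoch_Suc[of b] qpoch_Suc[of c]
    using nz[of b] nz[of c] 
    by (simp add: divide_simps del: power_Suc) (simp add: power_add algebra_simps)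
next
  case False
  \<comment> \<open>At the two edges \<open>B = 0\<close> and \<open>B = A + 1\<close> exactly one
    term on the right survives, because \<open>qbinom\<close> is 0 outside its range; beyond the
    edges everything vanishes.\<close>
  then consider "B < 0" | "B = 0" | "B = A + 1" | "B > A + 1"
    by linarith
  thus ?thesis
    using assms q by cases (auto simp: qbinom_eq_0)
qed

lemma qbinom_Pascal':
  assumes "A \<ge> 0"
  shows "qbinom (A + 1) B q = qbinom A B q + q powr of_int (A + 1 - B) * qbinom A (B - 1) q"
  using qbinom_Pascal[OF assms, of "A + 1 - B"] qbinom_symmetric[of A B q]
    qbinom_symmetric[of A "B - 1" q] qbinom_symmetric[of "A + 1" B q]
  by (simp add: algebra_simps)

text \<open>Inside the range both sides are the q-multinomial with parts m, r, k-r and L-m-k;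
  outside it both vanish. The right-hand form isolates the index m + r, which makes the sum over r a
  Vandermonde sum.\<close>

lemma qbinom_trinomial:
  assumes "L \<ge> 0"
  shows "qbinom L k q * qbinom (L - k) m q * qbinom k r q =
         qbinom L (m + r) q * qbinom (m + r) r q * qbinom (L - (m + r)) (k - r) q"
proof (cases "0 \<le> m \<and> 0 \<le> r \<and> r \<le> k \<and> m + k \<le> L")
  case True
  define a b c d where "a = nat m" and "b = nat r" and "c = nat (k - r)" and "d = nat (L - m - k)"
  have m: "m = int a" and r: "r = int b" and k: "k = int b + int c"
    and L: "L = int a + int b + int c + int d"
    using True by (auto simp: a_def b_def c_def d_def)
  have *: "qbinom L k q = qpoch (a + b + c + d) q / (qpoch (b + c) q * qpoch (a + d) q)"
    "qbinom (L - k) m q = qpoch (a + d) q / (qpoch a q * qpoch d q)"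
    "qbinom k r q = qpoch (b + c) q / (qpoch b q * qpoch c q)"
    "qbinom L (m + r) q = qpoch (a + b + c + d) q / (qpoch (a + b) q * qpoch (c + d) q)"
    "qbinom (m + r) r q = qpoch (a + b) q / (qpoch a q * qpoch b q)"
    "qbinom (L - (m + r)) (k - r) q = qpoch (c + d) q / (qpoch c q * qpoch d q)"
    using qbinom_add[of "b + c" "a + d" q] qbinom_add[of a d q] qbinom_add[of b c q]
      qbinom_add[of "a + b" "c + d" q] qbinom_add[of b a q] qbinom_add[of c d q]
    by (simp_all add: m r k L add_ac mult_ac)
  show ?thesis
    unfolding * by simp
next
  case False
  thus ?thesis
    using assms by (auto simp: qbinom_def)
qed

text \<open>Induction on \<open>n\<close> with \<open>c\<close> arbitrary: Pascal on the factor
  \<open>qbinom (int n) s q\<close> leaves a part with s-1, and the shift s -> s+1 turns it into the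
  same sum for c+1. The two results recombine by the other Pascal rule.\<close>

lemma q_Vandermonde:
  assumes "A \<ge> 0"
  shows "(\<Sum>s\<in>{0..int n}. q powr of_int (s * (s + c)) * qbinom A (s + c) q * qbinom (int n) s q) =
         qbinom (int n + A) (int n + c) q"
proof -
  let ?t = "\<lambda>n c s. q powr of_int (s * (s + c)) * qbinom A (s + c) q * qbinom (int n) s q"
  have "Sum_any (?t n c) = qbinom (int n + A) (int n + c) q"
  proof (induction n arbitrary: c)
    case 0
    have "{s. ?t 0 c s \<noteq> 0} \<subseteq> {0}"
      by (auto simp: qbinom_def split: if_splits)
    hence "Sum_any (?t 0 c) = sum (?t 0 c) {0}"
      by (intro Sum_any.expand_superset) auto
    thus ?case
      using q by simp
  next
    case (Suc n)
    let ?u = "\<lambda>s. q powr of_int (s * (s + c) + int n + 1 - s) * qbinom A (s + c) q *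
                  qbinom (int n) (s - 1) q"
    have "?t (Suc n) c s = ?t n c s + ?u s" for s
      using qbinom_Pascal'[of "int n" s]
      by (simp add: algebra_simps powr_add[symmetric])
    hence "Sum_any (?t (Suc n) c) = Sum_any (\<lambda>s. ?t n c s + ?u s)"
      by simp
    also have "\<dots> = Sum_any (?t n c) + Sum_any ?u"
      by (intro Sum_any.distrib finite_support_qbinom' finite_support_qbinom_diff)
    also have "Sum_any ?u = Sum_any (\<lambda>s. q powr of_int (int n + c + 1) * ?t n (c + 1) s)"
      by (rule Sum_any.reindex_cong[of "\<lambda>s. s + 1"])
         (auto simp: fun_eq_iff algebra_simps powr_add[symmetric] intro: bij_plus_right)
    also have "\<dots> = q powr of_int (int n + c + 1) * Sum_any (?t n (c + 1))"
      by (intro Sum_any_right_distrib[symmetric] finite_support_qbinom')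
    finally have "Sum_any (?t (Suc n) c) = qbinom (int n + A) (int n + c) q +
        q powr of_int (int n + c + 1) * qbinom (int n + A) (int n + (c + 1)) q"
      unfolding Suc.IH .
    also have "\<dots> = qbinom (int (Suc n) + A) (int (Suc n) + c) q"
      using qbinom_Pascal[of "int n + A" "int n + c + 1"] assms by (simp add: add_ac)
    finally show ?case .
  qed
  moreover have "Sum_any (?t n c) = sum (?t n c) {0..int n}"
    by (intro Sum_any.expand_superset) (auto simp: qbinom_def split: if_splits)
  ultimately show ?thesis
    by simp
qed

section \<open>Bressoud's finite Rogers--Ramanujan identity\<close>

lemma RR_sum_Suc: "RR_sum q c (Suc n) = RR_sum q c n + q powr of_int (int n + 1 + c) * RR_sum q (c + 1) n"
proof -
  let ?t = "\<lambda>c n k. q powr of_int (k\<^sup>2 + c * k) * qbinom (int n) k q"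
  let ?u = "\<lambda>k. q powr of_int (k\<^sup>2 + c * k + int n + 1 - k) * qbinom (int n) (k - 1) q"
  have "?t c (Suc n) k = ?t c n k + ?u k" for k
    using qbinom_Pascal'[of "int n" k]
    by (simp add: algebra_simps powr_add[symmetric])
  hence "Sum_any (?t c (Suc n)) = Sum_any (\<lambda>k. ?t c n k + ?u k)"
    by simp
  also have "\<dots> = Sum_any (?t c n) + Sum_any ?u"
    by (intro Sum_any.distrib finite_support_qbinom' finite_support_qbinom_diff)
  also have "Sum_any ?u = Sum_any (\<lambda>k. q powr of_int (int n + 1 + c) * ?t (c + 1) n k)"
    by (rule Sum_any.reindex_cong[of "\<lambda>k. k + 1"])
       (auto simp: fun_eq_iff algebra_simps power2_eq_square powr_add[symmetric] intro: bij_plus_right)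
  also have "\<dots> = q powr of_int (int n + 1 + c) * Sum_any (?t (c + 1) n)"
    by (intro Sum_any_right_distrib[symmetric] finite_support_qbinom')
  finally show ?thesis
    by (simp add: RR_sum_def)
qed

text \<open>The other Pascal rule yields a second recurrence, in which both terms are shifted.
  Together with \<open>RR_sum_Suc\<close> it eliminates the shift 2 in the induction for Bressoud's
  identity.\<close>

lemma RR_sum_Suc': "RR_sum q c (Suc n) = RR_sum q (c + 1) n + q powr of_int (c + 1) * RR_sum q (c + 2) n"
proof -
  let ?t = "\<lambda>c n k. q powr of_int (k\<^sup>2 + c * k) * qbinom (int n) k q"
  let ?u = "\<lambda>k. q powr of_int (k\<^sup>2 + c * k) * qbinom (int n) (k - 1) q"
  have "?t c (Suc n) k = ?t (c + 1) n k + ?u k" for k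
    using qbinom_Pascal[of "int n" k]
    by (simp add: algebra_simps powr_add)
  hence "Sum_any (?t c (Suc n)) = Sum_any (\<lambda>k. ?t (c + 1) n k + ?u k)"
    by simp
  also have "\<dots> = Sum_any (?t (c + 1) n) + Sum_any ?u"
    by (intro Sum_any.distrib finite_support_qbinom' finite_support_qbinom_diff)
  also have "Sum_any ?u = Sum_any (\<lambda>k. q powr of_int (c + 1) * ?t (c + 2) n k)"
    by (rule Sum_any.reindex_cong[of "\<lambda>k. k + 1"])
       (auto simp: fun_eq_iff algebra_simps power2_eq_square powr_add[symmetric] intro: bij_plus_right)
  also have "\<dots> = q powr of_int (c + 1) * Sum_any (?t (c + 2) n)"
    by (intro Sum_any_right_distrib[symmetric] finite_support_qbinom')
  finally show ?thesis
    by (simp add: RR_sum_def)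
qed

text \<open>Pascal at bottom index B - 2j contributes q^(B-2j); its j-dependent part lowers
  \<open>d\<close> by 2.\<close>

lemma alt_sum_Pascal:
  assumes "A \<ge> 0"
  shows "alt_sum q d (A + 1) B = alt_sum q d A (B - 1) + q powr of_int B * alt_sum q (d - 2) A B"
proof -
  let ?w = "\<lambda>d j. (-1) powi j * q powr (of_int (j * (5 * j + 1)) / 2 + of_int (d * j))"
  have "?w d j * qbinom (A + 1) (B - 2 * j) q =
        ?w d j * qbinom A (B - 1 - 2 * j) q + q powr of_int B * (?w (d - 2) j * qbinom A (B - 2 * j) q)" for j
    using qbinom_Pascal[OF assms, of "B - 2 * j"]
    by (simp add: algebra_simps powr_add[symmetric])
  hence "alt_sum q d (A + 1) B = Sum_any (\<lambda>j. ?w d j * qbinom A (B - 1 - 2 * j) q +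
           q powr of_int B * (?w (d - 2) j * qbinom A (B - 2 * j) q))"
    by (simp add: alt_sum_def)
  also have "\<dots> = Sum_any (\<lambda>j. ?w d j * qbinom A (B - 1 - 2 * j) q) +
      Sum_any (\<lambda>j. q powr of_int B * (?w (d - 2) j * qbinom A (B - 2 * j) q))"
    by (intro Sum_any.distrib finite_support_qbinom finite_support_scaled_qbinom) auto
  also have "Sum_any (\<lambda>j. q powr of_int B * (?w (d - 2) j * qbinom A (B - 2 * j) q)) =
      q powr of_int B * Sum_any (\<lambda>j. ?w (d - 2) j * qbinom A (B - 2 * j) q)"
    by (intro Sum_any_right_distrib[symmetric] finite_support_qbinom) auto
  finally show ?thesis
    by (simp add: alt_sum_def)
qed

text \<open>Substitute j -> c - j and use the symmetry of \<open>qbinom\<close>. The free parameter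
  \<open>c\<close> allows the reflected bottom index and linear shift to be adjusted to a sum
  already known.\<close>

lemma alt_sum_reflect:
  "alt_sum q d A B = (-1) powi c * q powr (of_int (c * (5 * c + 1)) / 2 + of_int (d * c)) *
     alt_sum q (- (5 * c + 1 + d)) A (A - B + 2 * c)"
proof -
  let ?w = "\<lambda>d j. (-1) powi j * q powr (of_int (j * (5 * j + 1)) / 2 + of_int (d * j))"
  have eq: "?w d (c - j) * qbinom A (B - 2 * (c - j)) q =
        ?w d c * (?w (- (5 * c + 1 + d)) j * qbinom A (A - B + 2 * c - 2 * j) q)" for j
  proof -
    have "(-1) powi (c - j) = (-1) powi c * ((-1) powi j :: real)"
      by (simp add: power_int_diff power_int_minus_one_minus field_simps
          flip: power_int_mult_distrib)
    moreover have "q powr (of_int ((c - j) * (5 * (c - j) + 1)) / 2 + of_int (d * (c - j))) =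
      q powr (of_int (c * (5 * c + 1)) / 2 + of_int (d * c)) *
      q powr (of_int (j * (5 * j + 1)) / 2 + of_int (- (5 * c + 1 + d) * j))"
      unfolding powr_add[symmetric] by (rule arg_cong) (simp add: field_simps)
    moreover have "qbinom A (B - 2 * (c - j)) q = qbinom A (A - B + 2 * c - 2 * j) q"
      using qbinom_symmetric[of A "B - 2 * (c - j)" q] by (simp add: algebra_simps)
    ultimately show ?thesis
      by simp
  qed
  have "bij (\<lambda>j. c - j)"
    by (rule involuntory_imp_bij) simp
  hence "alt_sum q d A B = Sum_any (\<lambda>j. ?w d c * (?w (- (5 * c + 1 + d)) j * qbinom A (A - B + 2 * c - 2 * j) q))"
    unfolding alt_sum_def
    by (rule Sum_any.reindex_cong) (simp only: o_def eq)
  also have "\<dots> = ?w d c * Sum_any (\<lambda>j. ?w (- (5 * c + 1 + d)) j * qbinom A (A - B + 2 * c - 2 * j) q)"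
    by (intro Sum_any_right_distrib[symmetric] finite_support_qbinom) auto
  finally show ?thesis
    by (simp add: alt_sum_def)
qed

lemma alt_sum_Pascal':
  assumes "A \<ge> 0"
  shows "alt_sum q d (A + 1) B = alt_sum q d A B + q powr of_int (A + 1 - B) * alt_sum q (d + 2) A (B - 1)"
proof -
  let ?w = "\<lambda>d j. (-1) powi j * q powr (of_int (j * (5 * j + 1)) / 2 + of_int (d * j))"
  have "?w d j * qbinom (A + 1) (B - 2 * j) q =
        ?w d j * qbinom A (B - 2 * j) q + q powr of_int (A + 1 - B) * (?w (d + 2) j * qbinom A (B - 1 - 2 * j) q)" for j
    using qbinom_Pascal'[OF assms, of "B - 2 * j"]
    by (simp add: algebra_simps powr_add[symmetric])
  hence "alt_sum q d (A + 1) B = Sum_any (\<lambda>j. ?w d j * qbinom A (B - 2 * j) q +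
           q powr of_int (A + 1 - B) * (?w (d + 2) j * qbinom A (B - 1 - 2 * j) q))"
    by (simp add: alt_sum_def)
  also have "\<dots> = Sum_any (\<lambda>j. ?w d j * qbinom A (B - 2 * j) q) +
      Sum_any (\<lambda>j. q powr of_int (A + 1 - B) * (?w (d + 2) j * qbinom A (B - 1 - 2 * j) q))"
    by (intro Sum_any.distrib finite_support_qbinom finite_support_scaled_qbinom) auto
  also have "Sum_any (\<lambda>j. q powr of_int (A + 1 - B) * (?w (d + 2) j * qbinom A (B - 1 - 2 * j) q)) =
      q powr of_int (A + 1 - B) * Sum_any (\<lambda>j. ?w (d + 2) j * qbinom A (B - 1 - 2 * j) q)"
    by (intro Sum_any_right_distrib[symmetric] finite_support_qbinom) auto
  finally show ?thesis
    by (simp add: alt_sum_def)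
qed

lemma alt_sum_odd: "alt_sum q 0 (2 * int n + 1) (int n) = alt_sum q 0 (2 * int n) (int n)"
proof -
  \<comment> \<open>Reflection with c = -1 fixes both the shift 2 and the bottom index n-1, has
    trivial power of q, and reverses the sign. So the correction term of
    \<open>alt_sum_Pascal'\<close> is its own negative and vanishes.\<close>
  have "alt_sum q 2 (2 * int n) (int n - 1) = - alt_sum q 2 (2 * int n) (int n - 1)"
    using q alt_sum_reflect[of 2 "2 * int n" "int n - 1" "-1"] by simp
  thus ?thesis
    using alt_sum_Pascal'[of "2 * int n" 0 "int n"] by simp
qed

lemma RR_sum_0 [simp]: "RR_sum q c 0 = 1"
proof -
  have "RR_sum q c 0 = (\<Sum>k\<in>{0}. q powr of_int (k\<^sup>2 + c * k) * qbinom (int 0) k q)"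
    unfolding RR_sum_def
    by (rule Sum_any.expand_superset) (auto simp: qbinom_def split: if_splits)
  thus ?thesis
    using q by simp
qed

text \<open>The two families need a simultaneous induction: Pascal sends the even case to the odd
  sum with shift -2, and the odd case at n+1 back to the even case at n+1.\<close>

theorem Bressoud_finite_RR:
  "alt_sum q 0 (2 * int n) (int n) = RR_sum q 0 n \<and>
   alt_sum q (-2) (2 * int n + 1) (int n + 1) = RR_sum q 1 n"
proof (induction n)
  case 0
  have "alt_sum q 0 0 0 = (\<Sum>j\<in>{0}. (-1) powi j * q powr (of_int (j * (5 * j + 1)) / 2 + of_int (0 * j))
     * qbinom 0 (0 - 2 * j) q)"
    unfolding alt_sum_def
    by (rule Sum_any.expand_superset) (auto simp: qbinom_def split: if_splits)
  moreover have "alt_sum q (-2) 1 1 = (\<Sum>j\<in>{0}. (-1) powi j * q powr (of_int (j * (5 * j + 1)) / 2 + of_int (-2 * j))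
     * qbinom 1 (1 - 2 * j) q)"
    unfolding alt_sum_def
    by (rule Sum_any.expand_superset) (auto simp: qbinom_def split: if_splits)
  moreover have "qbinom 1 1 q = 1"
    by simp
  ultimately show ?case
    using q by simp
next
  case (Suc n)
  let ?Q = "q powr (real n + 1)"
  have S: "alt_sum q 0 (2 * int (Suc n)) (int (Suc n)) = RR_sum q 0 (Suc n)"
    using alt_sum_Pascal[of "2 * int n + 1" 0 "int n + 1"] alt_sum_odd[of n] Suc.IH
      RR_sum_Suc[of 0 n]
    by (simp add: add_ac)
  have "alt_sum q (-2) (2 * int n + 2) (int n + 2) = alt_sum q (-2) (2 * int n + 1) (int n + 1) +
      q powr (real n + 2) * alt_sum q (-4) (2 * int n + 1) (int n + 2)"
    using alt_sum_Pascal[of "2 * int n + 1" "-2" "int n + 2"] by (simp add: add_ac)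
  \<comment> \<open>Reflection with c = 1 returns shift -4 to shift -2 and gives the prefactor
    -q^(3-4), so the whole expression becomes (1 - q^(n+1)) times the known sum.\<close>
  also have "alt_sum q (-4) (2 * int n + 1) (int n + 2) = - (q powr (-1)) * alt_sum q (-2) (2 * int n + 1) (int n + 1)"
    using alt_sum_reflect[of "-4" "2 * int n + 1" "int n + 2" 1] q by (simp add: powr_minus add_ac)
  also have "q powr (real n + 2) * (- (q powr (-1)) * alt_sum q (-2) (2 * int n + 1) (int n + 1)) =
      - (?Q * RR_sum q 1 n)"
  proof -
    have "q powr (real n + 2) * q powr (-1) = ?Q"
      unfolding powr_add[symmetric] by (rule arg_cong) simp
    thus ?thesis
      unfolding Suc.IH[THEN conjunct2] by (simp only: mult_minus_left mult_minus_right flip: mult.assoc)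
  qed
  finally have "alt_sum q (-2) (2 * int n + 2) (int n + 2) = RR_sum q 1 n - ?Q * RR_sum q 1 n"
    using Suc.IH by simp
  moreover have "alt_sum q (-2) (2 * int n + 3) (int n + 2) = alt_sum q (-2) (2 * int n + 2) (int n + 2) +
     ?Q * alt_sum q 0 (2 * int n + 2) (int n + 1)"
    using alt_sum_Pascal'[of "2 * int n + 2" "-2" "int n + 2"] by (simp add: add_ac)
  moreover have "alt_sum q 0 (2 * int n + 2) (int n + 1) = RR_sum q 0 (Suc n)"
    using S by (simp add: add_ac)
  \<comment> \<open>It remains that (1 - q^(n+1)) R1(n) + q^(n+1) R0(n+1) = R1(n+1), where Rc
    denotes \<open>RR_sum q c\<close>. Writing both values at n+1 through R1(n) and R2(n) makes the
    two sides agree.\<close>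
  moreover have "RR_sum q 0 (Suc n) = RR_sum q 1 n + q * RR_sum q 2 n"
    using RR_sum_Suc'[of 0 n] q by simp
  moreover have "RR_sum q 1 (Suc n) = RR_sum q 1 n + ?Q * q * RR_sum q 2 n"
    using RR_sum_Suc[of 1 n] q by (simp add: powr_add power2_eq_square)
  ultimately have "alt_sum q (-2) (2 * int n + 3) (int n + 2) = RR_sum q 1 (Suc n)"
    by (simp add: algebra_simps)
  thus ?case
    using S by (simp add: add_ac)
qed

section \<open>A positivity-preserving transformation\<close>

text \<open>With T(x) = x(x+1)/2, the cross terms cancel: T(s-r) + T(s+r+a) = T(a) + s(s+a+1) +
  r(r+a). Hence for fixed s the sum over r is a Vandermonde sum with top indices L-s and s.\<close>

lemma q_Vandermonde_double:
  fixes L :: nat and a :: int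
  shows "(\<Sum>s\<in>{0..int L}. \<Sum>r\<in>{0..int L}. q powr (of_int ((s - r) * (s - r + 1) + (s + r + a) * (s + r + a + 1)) / 2) *
           qbinom (int L) s q * qbinom s r q * qbinom (int L - s) (r + a) q) =
         q powr (of_int (a * (a + 1)) / 2) *
         (\<Sum>s\<in>{0..int L}. q powr of_int (s * (s + a + 1)) * qbinom (int L) s q * qbinom (int L) (s + a) q)"
proof -
  have "(\<Sum>r\<in>{0..int L}. q powr (of_int ((s - r) * (s - r + 1) + (s + r + a) * (s + r + a + 1)) / 2) *
           qbinom (int L) s q * qbinom s r q * qbinom (int L - s) (r + a) q) =
        q powr (of_int (a * (a + 1)) / 2) *
        (q powr of_int (s * (s + a + 1)) * qbinom (int L) s q * qbinom (int L) (s + a) q)"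
    if s: "s \<in> {0..int L}" for s
  proof -
    \<comment> \<open>Terms with r > s vanish, and cutting them off gives the range that
      \<open>q_Vandermonde\<close> expects for n = s.\<close>
    have "(\<Sum>r\<in>{0..int L}. q powr (of_int ((s - r) * (s - r + 1) + (s + r + a) * (s + r + a + 1)) / 2) *
           qbinom (int L) s q * qbinom s r q * qbinom (int L - s) (r + a) q) =
       (\<Sum>r\<in>{0..s}. q powr (of_int ((s - r) * (s - r + 1) + (s + r + a) * (s + r + a + 1)) / 2) *
           qbinom (int L) s q * qbinom s r q * qbinom (int L - s) (r + a) q)"
      using s by (intro sum.mono_neutral_right) (auto simp: qbinom_eq_0)
    also have "\<dots> = (\<Sum>r\<in>{0..s}. q powr (of_int (a * (a + 1)) / 2) * q powr of_int (s * (s + a + 1)) *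
        qbinom (int L) s q * (q powr of_int (r * (r + a)) * qbinom (int L - s) (r + a) q * qbinom s r q))"
    proof (rule sum.cong[OF refl])
      fix r
      have "q powr (of_int ((s - r) * (s - r + 1) + (s + r + a) * (s + r + a + 1)) / 2) =
        q powr (of_int (a * (a + 1)) / 2) * q powr of_int (s * (s + a + 1)) * q powr of_int (r * (r + a))"
        unfolding powr_add[symmetric] by (rule arg_cong) (simp add: field_simps)
      thus "q powr (of_int ((s - r) * (s - r + 1) + (s + r + a) * (s + r + a + 1)) / 2) *
           qbinom (int L) s q * qbinom s r q * qbinom (int L - s) (r + a) q =
        q powr (of_int (a * (a + 1)) / 2) * q powr of_int (s * (s + a + 1)) *
        qbinom (int L) s q * (q powr of_int (r * (r + a)) * qbinom (int L - s) (r + a) q * qbinom s r q)"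
        by simp
    qed
    also have "\<dots> = q powr (of_int (a * (a + 1)) / 2) * q powr of_int (s * (s + a + 1)) *
        qbinom (int L) s q * qbinom (int L) (s + a) q"
      using q_Vandermonde[where A = "int L - s" and n = "nat s" and c = a] s by (simp add: sum_distrib_left[symmetric])
    finally show ?thesis
      by simp
  qed
  thus ?thesis
    by (simp add: sum_distrib_left)
qed

lemma qbinom_transformation:
  fixes L :: nat and b :: int
  shows "(\<Sum>k\<in>{0..int L}. \<Sum>m\<in>{0..int L}. trans_coeff q (int L) k m * qbinom k (k div 2 - b) q) =
         q powr of_int (b * (2 * b + 1)) * qbinom (2 * int L + 1) (int L - 2 * b) q"
proof -
  let ?F = "\<lambda>k m. trans_coeff q (int L) k m * qbinom k (k div 2 - b) q"
  let ?E = "\<lambda>a s r. q powr (of_int ((s - r) * (s - r + 1) + (s + r + a) * (s + r + a + 1)) / 2) *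
           qbinom (int L) s q * qbinom s r q * qbinom (int L - s) (r + a) q"
  let ?V = "\<lambda>a. \<Sum>s\<in>{0..int L}. q powr of_int (s * (s + a + 1)) * qbinom (int L) s q * qbinom (int L) (s + a) q"
  define I where "I = {0..int L}"
  have fin: "finite I"
    by (simp add: I_def)
  \<comment> \<open>New indices: e is the parity of k, r is the bottom index k div 2 - b, and s = m
    + r. Then k - r = r + a and m + k = s + r + a for a = 2b + e.\<close>
  have F_E: "?F (2 * r + 2 * b + e) (s - r) = ?E (2 * b + e) s r" if "e \<in> {0, 1}" for e s r
  proof -
    have "(2 * r + 2 * b + e) div 2 - b = r"
      using that by auto
    thus ?thesis
      using qbinom_trinomial[of "int L" "2 * r + 2 * b + e" "s - r" r]
      by (simp add: trans_coeff_def algebra_simps)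
  qed
  have "(\<Sum>k\<in>I. \<Sum>m\<in>I. ?F k m) = (\<Sum>(k, m)\<in>I \<times> I. ?F k m)"
    by (simp add: sum.cartesian_product)
  \<comment> \<open>The change of indices does not map one box onto the other, only the nonzero
    terms correspond. The zero terms on either side are therefore discarded as neutral, and
    nonvanishing of the binomials puts the images into the boxes.\<close>
  also have "\<dots> = (\<Sum>(e, s, r)\<in>{0, 1} \<times> I \<times> I. ?E (2 * b + e) s r)"
  proof (rule sum.reindex_bij_witness_not_neutral[
        where i = "\<lambda>(e, s, r). (2 * r + 2 * b + e, s - r)"
          and j = "\<lambda>(k, m). (k mod 2, m + k div 2 - b, k div 2 - b)"
          and S' = "{(k, m) \<in> I \<times> I. ?F k m = 0}"
          and T' = "{(e, s, r) \<in> {0, 1} \<times> I \<times> I. ?E (2 * b + e) s r = 0}"])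
    show "finite {(k, m) \<in> I \<times> I. ?F k m = 0}"
      using fin by (auto intro: finite_subset[of _ "I \<times> I"])
    show "finite {(e, s, r) \<in> {0, 1} \<times> I \<times> I. ?E (2 * b + e) s r = 0}"
      using fin by (auto intro: finite_subset[of _ "{0, 1} \<times> I \<times> I"])
  next
    fix x assume x: "x \<in> I \<times> I - {(k, m) \<in> I \<times> I. ?F k m = 0}"
    obtain k m where [simp]: "x = (k, m)" by force
    define e r s where "e = k mod 2" and "r = k div 2 - b" and "s = m + r"
    have k: "k = 2 * r + 2 * b + e" and m: "m = s - r" and e: "e \<in> {0, 1}"
      by (auto simp: e_def r_def s_def)
    have FE: "?F k m = ?E (2 * b + e) s r"
      using F_E[OF e, of r s] unfolding k[symmetric] m[symmetric] unfolding m .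
    have "?F k m \<noteq> 0"
      using x by auto
    hence "?E (2 * b + e) s r \<noteq> 0"
      by (simp only: FE not_False_eq_True)
    moreover from this have "s \<in> I" "r \<in> I"
      by (auto simp: I_def qbinom_def split: if_splits)
    moreover have j: "(k mod 2, m + k div 2 - b, k div 2 - b) = (e, s, r)"
      by (simp add: e_def s_def r_def)
    ultimately show "(case x of (k, m) \<Rightarrow> (k mod 2, m + k div 2 - b, k div 2 - b)) \<in>
       {0, 1} \<times> I \<times> I - {(e, s, r) \<in> {0, 1} \<times> I \<times> I. ?E (2 * b + e) s r = 0}"
      using e by simp
    show "(case case x of (k, m) \<Rightarrow> (k mod 2, m + k div 2 - b, k div 2 - b) of
             (e, s, r) \<Rightarrow> (2 * r + 2 * b + e, s - r)) = x"
      by simp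
  next
    fix y assume y: "y \<in> {0, 1} \<times> I \<times> I - {(e, s, r) \<in> {0, 1} \<times> I \<times> I. ?E (2 * b + e) s r = 0}"
    obtain e s r where [simp]: "y = (e, s, r)" by (cases y) auto
    have e: "e \<in> {0, 1}" and nz: "?E (2 * b + e) s r \<noteq> 0"
      using y by auto
    from nz have "?F (2 * r + 2 * b + e) (s - r) \<noteq> 0"
      by (simp only: F_E[OF e] not_False_eq_True)
    moreover from nz have "2 * r + 2 * b + e \<in> I" "s - r \<in> I"
      by (auto simp: I_def qbinom_def split: if_splits)
    ultimately show "(case y of (e, s, r) \<Rightarrow> (2 * r + 2 * b + e, s - r)) \<in>
        I \<times> I - {(k, m) \<in> I \<times> I. ?F k m = 0}"
      by simp
    have "e = 0 \<or> e = 1"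
      using e by simp
    hence "(2 * r + 2 * b + e) mod 2 = e" "(2 * r + 2 * b + e) div 2 = r + b"
      by presburger+
    thus "(case case y of (e, s, r) \<Rightarrow> (2 * r + 2 * b + e, s - r) of
             (k, m) \<Rightarrow> (k mod 2, m + k div 2 - b, k div 2 - b)) = y"
      by simp
  next
    fix x :: "int \<times> int"
    obtain k m where x: "x = (k, m)" by force
    define e r s where "e = k mod 2" and "r = k div 2 - b" and "s = m + r"
    have k: "k = 2 * r + 2 * b + e" and m: "m = s - r" and e: "e \<in> {0, 1}"
      by (auto simp: e_def r_def s_def)
    have j: "(k mod 2, m + k div 2 - b, k div 2 - b) = (e, s, r)"
      by (simp add: e_def s_def r_def)
    have FE: "?F k m = ?E (2 * b + e) s r"
      using F_E[OF e, of r s] unfolding k[symmetric] m[symmetric] unfolding m .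
    show "(case case x of (k, m) \<Rightarrow> (k mod 2, m + k div 2 - b, k div 2 - b) of
             (e, s, r) \<Rightarrow> ?E (2 * b + e) s r) = (case x of (k, m) \<Rightarrow> ?F k m)"
      unfolding x prod.case j using FE by (rule sym)
  qed auto
  also have "\<dots> = (\<Sum>e\<in>{0, 1}. \<Sum>s\<in>I. \<Sum>r\<in>I. ?E (2 * b + e) s r)"
    by (simp only: sum.cartesian_product)
  also have "\<dots> = (\<Sum>s\<in>I. \<Sum>r\<in>I. ?E (2 * b) s r) + (\<Sum>s\<in>I. \<Sum>r\<in>I. ?E (2 * b + 1) s r)"
    by simp
  also have "\<dots> = q powr (of_int (2 * b * (2 * b + 1)) / 2) * ?V (2 * b) +
                  q powr (of_int ((2 * b + 1) * (2 * b + 1 + 1)) / 2) * ?V (2 * b + 1)"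
    unfolding I_def q_Vandermonde_double ..
  \<comment> \<open>T(2b+1) = T(2b) + 2b+1. The extra q^(2b+1) is what Pascal needs to merge the
    even and odd parts into a single sum with top index L+1, ready for the second Vandermonde
    summation.\<close>
  also have "q powr (of_int ((2 * b + 1) * (2 * b + 1 + 1)) / 2) =
             q powr of_int (b * (2 * b + 1)) * q powr of_int (2 * b + 1)"
    unfolding powr_add[symmetric] by (rule arg_cong) (simp add: field_simps)
  also have "q powr (of_int (2 * b * (2 * b + 1)) / 2) = q powr of_int (b * (2 * b + 1))"
    by simp
  also have "q powr of_int (b * (2 * b + 1)) * ?V (2 * b) +
             q powr of_int (b * (2 * b + 1)) * q powr of_int (2 * b + 1) * ?V (2 * b + 1) =
     q powr of_int (b * (2 * b + 1)) *
     (\<Sum>s\<in>I. q powr of_int (s * (s + (2 * b + 1))) * qbinom (int L + 1) (s + (2 * b + 1)) q * qbinom (int L) s q)"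
  proof -
    have "q powr of_int (s * (s + (2 * b + 1))) * qbinom (int L + 1) (s + (2 * b + 1)) q * qbinom (int L) s q =
       q powr of_int (s * (s + 2 * b + 1)) * qbinom (int L) s q * qbinom (int L) (s + 2 * b) q +
       q powr of_int (2 * b + 1) *
        (q powr of_int (s * (s + (2 * b + 1) + 1)) * qbinom (int L) s q * qbinom (int L) (s + (2 * b + 1)) q)" for s
      using qbinom_Pascal[of "int L" "s + (2 * b + 1)"]
      by (simp add: algebra_simps powr_add[symmetric])
    thus ?thesis
      by (simp add: I_def sum.distrib sum_distrib_left distrib_left mult.assoc add.assoc)
  qed
  also have "\<dots> = q powr of_int (b * (2 * b + 1)) * qbinom (2 * int L + 1) (int L + (2 * b + 1)) q"
    unfolding I_def by (subst q_Vandermonde) (simp_all add: algebra_simps)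
  also have "qbinom (2 * int L + 1) (int L + (2 * b + 1)) q = qbinom (2 * int L + 1) (int L - 2 * b) q"
    using qbinom_symmetric[of "2 * int L + 1" "int L - 2 * b" q] by (simp add: algebra_simps)
  finally show ?thesis
    by (simp add: I_def)
qed

section \<open>Reduction of \<open>G\<close> to Rogers-Ramanujan polynomials\<close>

lemma alt_sum_div_2:
  assumes "k \<ge> 0"
  shows "alt_sum q 0 k (k div 2) = RR_sum q 0 (nat (k div 2))"
proof -
  define n where "n = nat (k div 2)"
  have "k = 2 * int n \<or> k = 2 * int n + 1"
    using assms by (auto simp: n_def)
  thus ?thesis
    using Bressoud_finite_RR[of n] alt_sum_odd[of n] by auto
qed

lemma G_eq:
  "G L (L + 1) (13 / 4) 2 4 q =
   (\<Sum>k\<in>{0..int L}. \<Sum>m\<in>{0..int L}. trans_coeff q (int L) k m * RR_sum q 0 (nat (k div 2)))"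
proof -
  let ?w = "\<lambda>j::int. (-1) powi j * q powr (of_int (j * (5 * j + 1)) / 2 + of_int (0 * j))"
  have G_term: "G_term L (L + 1) (13 / 4) 2 4 q j =
     (\<Sum>k\<in>{0..int L}. \<Sum>m\<in>{0..int L}. trans_coeff q (int L) k m * (?w j * qbinom k (k div 2 - 2 * j) q))" for j
  proof -
    have "G_term L (L + 1) (13 / 4) 2 4 q j =
      ?w j * (q powr of_int (2 * j * (2 * (2 * j) + 1)) * qbinom (2 * int L + 1) (int L - 2 * (2 * j)) q)"
    proof -
      have "q powr (real 4 * of_int j * (((13 / 4 + 2) * of_int j + (13 / 4 - 2)) / 2)) =
        q powr (of_int (j * (5 * j + 1)) / 2 + of_int (0 * j)) * q powr of_int (2 * j * (2 * (2 * j) + 1))"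
        unfolding powr_add[symmetric] by (rule arg_cong) (simp add: field_simps)
      thus ?thesis
        by (simp add: G_term_def)
    qed
    also have "\<dots> = ?w j * (\<Sum>k\<in>{0..int L}. \<Sum>m\<in>{0..int L}. trans_coeff q (int L) k m * qbinom k (k div 2 - 2 * j) q)"
      by (simp only: qbinom_transformation)
    finally show ?thesis
      by (simp add: sum_distrib_left mult_ac)
  qed
  \<comment> \<open>One finite range containing the support in j of \<open>G_term\<close> and of all
    inner alternating sums, so that the sum over j can be interchanged with those over k and
    m.\<close>
  define J where "J = {- int L - 1..int L}"
  have J: "Sum_any (\<lambda>j. ?w j * qbinom k (k div 2 - 2 * j) q) = (\<Sum>j\<in>J. ?w j * qbinom k (k div 2 - 2 * j) q)"
    if "k \<in> {0..int L}" for k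
    using that
    by (intro Sum_any.expand_superset) (auto simp: J_def qbinom_def split: if_splits)
  have "G L (L + 1) (13 / 4) 2 4 q = (\<Sum>j\<in>J. G_term L (L + 1) (13 / 4) 2 4 q j)"
    unfolding G_def
    by (intro Sum_any.expand_superset) (auto simp: J_def G_term_def qbinom_def split: if_splits)
  also have "\<dots> = (\<Sum>k\<in>{0..int L}. \<Sum>m\<in>{0..int L}. \<Sum>j\<in>J.
      trans_coeff q (int L) k m * (?w j * qbinom k (k div 2 - 2 * j) q))"
    unfolding G_term by (subst sum.swap) (intro sum.cong refl sum.swap)
  also have "\<dots> = (\<Sum>k\<in>{0..int L}. \<Sum>m\<in>{0..int L}. trans_coeff q (int L) k m * alt_sum q 0 k (k div 2))"
    unfolding sum_distrib_left[symmetric] alt_sum_def by (intro sum.cong refl) (simp only: J)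
  also have "\<dots> = (\<Sum>k\<in>{0..int L}. \<Sum>m\<in>{0..int L}. trans_coeff q (int L) k m * RR_sum q 0 (nat (k div 2)))"
    by (intro sum.cong refl) (simp add: alt_sum_div_2)
  finally show ?thesis .
qed

end

section \<open>Positivity\<close>

lemma nonneg_poly_cong:
  "(\<And>q. 0 < q \<Longrightarrow> q < 1 \<Longrightarrow> P q = Q q) \<Longrightarrow> nonneg_poly P \<longleftrightarrow> nonneg_poly Q"
  by (auto simp: nonneg_poly_def)

lemma nonneg_poly_0: "nonneg_poly (\<lambda>_. 0)"
  by (auto simp: nonneg_poly_def intro!: exI[of _ 0])

lemma nonneg_poly_power: "nonneg_poly (\<lambda>q. q ^ n)"
  unfolding nonneg_poly_def by (rule exI[of _ "monom 1 n"]) (auto simp: poly_monom)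

lemma nonneg_poly_add: "nonneg_poly P \<Longrightarrow> nonneg_poly Q \<Longrightarrow> nonneg_poly (\<lambda>q. P q + Q q)"
  unfolding nonneg_poly_def by (metis (no_types, lifting) add_nonneg_nonneg coeff_add poly_add)

lemma nonneg_poly_mult:
  assumes "nonneg_poly P" "nonneg_poly Q"
  shows "nonneg_poly (\<lambda>q. P q * Q q)"
proof -
  obtain p r where "\<forall>i. coeff p i \<ge> 0" "\<forall>q. 0 < q \<and> q < 1 \<longrightarrow> P q = poly p q"
    "\<forall>i. coeff r i \<ge> 0" "\<forall>q. 0 < q \<and> q < 1 \<longrightarrow> Q q = poly r q"
    using assms by (auto simp: nonneg_poly_def)
  thus ?thesis
    unfolding nonneg_poly_def
    by (intro exI[of _ "p * r"]) (auto simp: coeff_mult intro!: sum_nonneg)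
qed

lemma nonneg_poly_sum: "(\<And>x. x \<in> A \<Longrightarrow> nonneg_poly (P x)) \<Longrightarrow> nonneg_poly (\<lambda>q. \<Sum>x\<in>A. P x q)"
  by (induction A rule: infinite_finite_induct) (auto intro: nonneg_poly_0 nonneg_poly_add)

lemma nonneg_poly_powr: "nonneg_poly (\<lambda>q. q powr of_int n)" if "n \<ge> 0"
proof -
  have "q powr of_int n = q ^ nat n" if "0 < q" for q :: real
    using that \<open>n \<ge> 0\<close> powr_realpow[of q "nat n"] by simp
  thus ?thesis
    using nonneg_poly_power[of "nat n"] by (subst nonneg_poly_cong) auto
qed

text \<open>The defining quotient does not show polynomiality; the Pascal rule does, by induction. A
  negative \<open>B\<close> is treated apart, since q^B would then not be a polynomial.\<close>

lemma nonneg_poly_qbinom_nat: "nonneg_poly (qbinom (int n) B)"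
proof (induction n arbitrary: B)
  case 0
  have "qbinom 0 B = (\<lambda>q. if B = 0 then q ^ 0 else 0)"
    by (auto simp: qbinom_def)
  thus ?case
    using nonneg_poly_0 nonneg_poly_power[of 0] by (cases "B = 0") simp_all
next
  case (Suc n)
  show ?case
  proof (cases "B \<ge> 0")
    case True
    have "nonneg_poly (\<lambda>q. qbinom (int n) (B - 1) q + q powr of_int B * qbinom (int n) B q)"
      by (intro nonneg_poly_add nonneg_poly_mult nonneg_poly_powr Suc.IH True)
    moreover have "qbinom (int (Suc n)) B q = qbinom (int n) (B - 1) q + q powr of_int B * qbinom (int n) B q"
      if "0 < q" "q < 1" for q
      using qbinom_Pascal[OF that, of "int n" B] by (simp add: add_ac)
    ultimately show ?thesis
      by (subst nonneg_poly_cong) auto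
  next
    case False
    hence "qbinom (int (Suc n)) B = (\<lambda>_. 0)"
      by (auto simp: qbinom_def)
    thus ?thesis
      using nonneg_poly_0 by simp
  qed
qed

lemma nonneg_poly_qbinom: "nonneg_poly (qbinom A B)"
proof (cases "A \<ge> 0")
  case True
  thus ?thesis
    using nonneg_poly_qbinom_nat[of "nat A" B] by simp
next
  case False
  hence "qbinom A B = (\<lambda>_. 0)"
    by (auto simp: qbinom_def)
  thus ?thesis
    using nonneg_poly_0 by simp
qed

lemma nonneg_poly_RR_sum: "nonneg_poly (\<lambda>q. RR_sum q 0 n)"
proof -
  have "RR_sum q 0 n = (\<Sum>k\<in>{0..int n}. q powr of_int (k\<^sup>2) * qbinom (int n) k q)" for q
  proof -
    have "RR_sum q 0 n = (\<Sum>k\<in>{0..int n}. q powr of_int (k\<^sup>2 + 0 * k) * qbinom (int n) k q)"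
      unfolding RR_sum_def
      by (rule Sum_any.expand_superset) (auto simp: qbinom_def split: if_splits)
    thus ?thesis
      by simp
  qed
  thus ?thesis
    by (auto intro!: nonneg_poly_sum nonneg_poly_mult nonneg_poly_powr nonneg_poly_qbinom
        simp del: of_int_power)
qed

text \<open>The halved exponent is a sum of two triangular numbers, hence an integer, and it is
  nonnegative because \<open>k\<close> and \<open>m\<close> are.\<close>

lemma nonneg_poly_trans_coeff:
  assumes "k \<ge> 0" "m \<ge> 0"
  shows "nonneg_poly (\<lambda>q. trans_coeff q L k m)"
proof -
  have "even (m * (m + 1) + (m + k) * (m + k + 1))"
    by (cases "even m"; cases "even k") simp_all
  then obtain e where e: "m * (m + 1) + (m + k) * (m + k + 1) = 2 * e"
    by (elim evenE)
  moreover have "m * (m + 1) + (m + k) * (m + k + 1) \<ge> 0"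
    using assms by simp
  ultimately have "e \<ge> 0"
    by simp
  thus ?thesis
    unfolding trans_coeff_def e
    by (auto intro!: nonneg_poly_mult nonneg_poly_powr nonneg_poly_qbinom)
qed

theorem mainTheorem12:
  fixes L :: nat
  shows "nonneg_poly (\<lambda>q. G L (L + 1) (13 / 4) 2 4 q)"
proof -
  have "nonneg_poly (\<lambda>q. \<Sum>k\<in>{0..int L}. \<Sum>m\<in>{0..int L}.
          trans_coeff q (int L) k m * RR_sum q 0 (nat (k div 2)))"
    by (intro nonneg_poly_sum nonneg_poly_mult nonneg_poly_RR_sum nonneg_poly_trans_coeff) auto
  thus ?thesis
    using G_eq by (subst nonneg_poly_cong) auto
qed

end
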